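(* Let $W$ be a bounded operator on $\mathcal H$. For every partition $\kappa=\{X_1,\dots,X_K\}$ of $\mathcal X$, $$\|W\|_\mu^2\le\sum_{k=1}^K\|\pi_{X_k}W\|_\mu^2 .$$
   Context: $(\mathcal X,\mathcal B,\mu)$ is a probability measure space and $\mathcal H=L^2(\mathcal X,\mu)$ (complex-valued). For $X\in\mathcal B$, $\pi_X:\mathcal H\to\mathcal H$ is the orthogonal projector $\pi_Xf=\mathbf 1_X f$. A partition is a finite family $\chi=\{Y_1,\dots,Y_J\}\subset\mathcal B$ with $\mu(\mathcal X\setminus\bigcup_j Y_j)=0$ and $\mu(Y_j\cap Y_k)=0$ for $j\ne k$. For a bounded operator $W$ on $\mathcal H$ with operator norm $\|W\|$, put $\mathcal M_\chi(W)=\sum_{j=1}^J\mu(Y_j)\|W\pi_{Y_j}\|^2$, and define the $\mu$-norm $\|W\|_\mu=\inf_\chi\sqrt{\mathcal M_\chi(W)}$, the infimum being over all partitions $\chi$. *)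

theory Defs
  imports "HOL-Probability.Probability"
begin

text \<open>
  Vectors of the Hilbert space of complex-valued square-integrable functions are
  given by representatives: measurable square-integrable functions, equality of vectors
  being equality almost everywhere.  An operator on the Hilbert space is given by
  a map on representatives whose algebraic laws hold almost everywhere.
\<close>

definition L2_space :: "'a measure \<Rightarrow> ('a \<Rightarrow> complex) set" where
  "L2_space M = {f \<in> borel_measurable M. integrable M (\<lambda>x. (cmod (f x))\<^sup>2)}"

definition L2_norm :: "'a measure \<Rightarrow> ('a \<Rightarrow> complex) \<Rightarrow> real" where
  "L2_norm M f = sqrt (\<integral>x. (cmod (f x))\<^sup>2 \<partial>M)"

definition bounded_operator ::
  "'a measure \<Rightarrow> (('a \<Rightarrow> complex) \<Rightarrow> ('a \<Rightarrow> complex)) \<Rightarrow> bool" where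
  "bounded_operator M W \<longleftrightarrow>
     (\<forall>f\<in>L2_space M. W f \<in> L2_space M) \<and>
     (\<forall>f\<in>L2_space M. \<forall>g\<in>L2_space M.
        AE x in M. W (\<lambda>y. f y + g y) x = W f x + W g x) \<and>
     (\<forall>c. \<forall>f\<in>L2_space M. AE x in M. W (\<lambda>y. c * f y) x = c * W f x) \<and>
     (\<exists>C. \<forall>f\<in>L2_space M. L2_norm M (W f) \<le> C * L2_norm M f)"

text \<open>
  Well-definedness on almost-everywhere classes is not a separate clause,
  because it follows from linearity and boundedness.
\<close>

lemma bounded_operator_cong_AE:
  assumes W: "bounded_operator M W"
    and f: "f \<in> L2_space M" and g: "g \<in> L2_space M"
    and eq: "AE x in M. f x = g x"
  shows "AE x in M. W f x = W g x"
proof -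
  define h where "h = (\<lambda>x. f x - g x)"
  have fm: "f \<in> borel_measurable M" and gm: "g \<in> borel_measurable M"
    using f g by (auto simp: L2_space_def)
  have hm: "h \<in> borel_measurable M"
    unfolding h_def using fm gm by measurable
  have h0: "AE x in M. (cmod (h x))\<^sup>2 = 0"
    using eq by eventually_elim (simp add: h_def)
  have hi: "integrable M (\<lambda>x. (cmod (h x))\<^sup>2)"
    using integrable_cong_AE[of "\<lambda>x. (cmod (h x))\<^sup>2" M "\<lambda>x. 0"] hm h0 by simp
  have h: "h \<in> L2_space M"
    using hm hi by (simp add: L2_space_def)
  have "(\<integral>x. (cmod (h x))\<^sup>2 \<partial>M) = 0"
    using integral_cong_AE[of "\<lambda>x. (cmod (h x))\<^sup>2" M "\<lambda>x. 0"] hm h0 by simp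
  then have hn: "L2_norm M h = 0"
    by (simp add: L2_norm_def)
  have Wh: "W h \<in> L2_space M" and "L2_norm M (W h) \<le> 0"
    using W h hn by (auto simp: bounded_operator_def)
  then have "(\<integral>x. (cmod (W h x))\<^sup>2 \<partial>M) \<le> 0"
    by (simp add: L2_norm_def)
  then have "(\<integral>x. (cmod (W h x))\<^sup>2 \<partial>M) = 0"
    by (intro antisym integral_nonneg_AE) auto
  then have "AE x in M. (cmod (W h x))\<^sup>2 = 0"
    using Wh by (subst (asm) integral_nonneg_eq_0_iff_AE) (auto simp: L2_space_def)
  moreover have "AE x in M. W (\<lambda>y. g y + h y) x = W g x + W h x"
    using W g h by (simp add: bounded_operator_def)
  moreover have "(\<lambda>y. g y + h y) = f"
    by (simp add: h_def)
  ultimately show ?thesis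
    by auto
qed

definition operator_norm ::
  "'a measure \<Rightarrow> (('a \<Rightarrow> complex) \<Rightarrow> ('a \<Rightarrow> complex)) \<Rightarrow> real" where
  "operator_norm M W = (SUP f\<in>{f \<in> L2_space M. L2_norm M f \<le> 1}. L2_norm M (W f))"

definition set_projector :: "'a set \<Rightarrow> ('a \<Rightarrow> complex) \<Rightarrow> ('a \<Rightarrow> complex)" where
  "set_projector X f = (\<lambda>x. indicator X x * f x)"

text \<open>
  The partition is the indexed family \<open>Y 1, \<dots>, Y J\<close>; values of \<open>Y\<close>
  outside \<open>{1..J}\<close> are irrelevant, and members may be empty or null.
\<close>

definition is_partition :: "'a measure \<Rightarrow> nat \<Rightarrow> (nat \<Rightarrow> 'a set) \<Rightarrow> bool" where
  "is_partition M J Y \<longleftrightarrow>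
     (\<forall>j\<in>{1..J}. Y j \<in> sets M) \<and>
     measure M (space M - (\<Union>j\<in>{1..J}. Y j)) = 0 \<and>
     (\<forall>j\<in>{1..J}. \<forall>k\<in>{1..J}. j \<noteq> k \<longrightarrow> measure M (Y j \<inter> Y k) = 0)"

definition M_part ::
  "'a measure \<Rightarrow> nat \<Rightarrow> (nat \<Rightarrow> 'a set) \<Rightarrow> (('a \<Rightarrow> complex) \<Rightarrow> ('a \<Rightarrow> complex)) \<Rightarrow> real" where
  "M_part M J Y W = (\<Sum>j=1..J. measure M (Y j) * (operator_norm M (W \<circ> set_projector (Y j)))\<^sup>2)"

definition mu_norm ::
  "'a measure \<Rightarrow> (('a \<Rightarrow> complex) \<Rightarrow> ('a \<Rightarrow> complex)) \<Rightarrow> real" where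
  "mu_norm M W = Inf {sqrt (M_part M J Y W) | J Y. is_partition M J Y}"

end

theory Submission
  imports Defs
begin

text \<open>
  Choose for each \<open>k\<close> a partition that is nearly optimal for \<open>\<pi>\<^sub>X\<^sub>k W\<close> and let \<open>U\<close> be a
  common refinement.  Passing to a refinement does not increase \<open>\<M>\<close>, because
  \<open>\<parallel>V \<pi>\<^sub>A\<parallel>\<close> is increasing in \<open>A\<close>.  On each cell of \<open>U\<close>, Pythagoras gives
  \<open>\<parallel>W \<pi>\<^sub>U\<parallel>\<^sup>2 \<le> \<Sum>\<^sub>k \<parallel>\<pi>\<^sub>X\<^sub>k W \<pi>\<^sub>U\<parallel>\<^sup>2\<close>, and summing over the cells of \<open>U\<close> yields the claim.
\<close>

section \<open>Square-integrable functions and cut-offs by indicators\<close>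

lemma L2_norm_nonneg: "0 \<le> L2_norm M f"
  by (simp add: L2_norm_def)

lemma L2_norm_power2: "(L2_norm M f)\<^sup>2 = (\<integral>x. (cmod (f x))\<^sup>2 \<partial>M)"
  by (simp add: L2_norm_def)

lemma zero_in_L2_space: "(\<lambda>x. 0) \<in> L2_space M"
  by (simp add: L2_space_def)

lemma L2_norm_zero: "L2_norm M (\<lambda>x. 0) = 0"
  by (simp add: L2_norm_def)

lemma cmod_set_projector_power2:
  "(cmod (set_projector A f x))\<^sup>2 = indicator A x * (cmod (f x))\<^sup>2"
  by (simp add: set_projector_def indicator_def)

lemma set_projector_in_L2_space:
  assumes "A \<in> sets M" "f \<in> L2_space M"
  shows "set_projector A f \<in> L2_space M"
proof -
  have [measurable]: "f \<in> borel_measurable M" "A \<in> sets M"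
    and i: "integrable M (\<lambda>x. (cmod (f x))\<^sup>2)"
    using assms by (auto simp: L2_space_def)
  have "set_projector A f \<in> borel_measurable M"
    unfolding set_projector_def by measurable
  moreover have "integrable M (\<lambda>x. (cmod (set_projector A f x))\<^sup>2)"
    unfolding cmod_set_projector_power2
    using integrable_mult_indicator[OF assms(1) i] by simp
  ultimately show ?thesis
    by (simp add: L2_space_def)
qed

lemma L2_norm_set_projector_le:
  assumes "A \<in> sets M" "f \<in> L2_space M"
  shows "L2_norm M (set_projector A f) \<le> L2_norm M f"
  unfolding L2_norm_def
proof (rule real_sqrt_le_mono, rule integral_mono)
  show "integrable M (\<lambda>x. (cmod (set_projector A f x))\<^sup>2)"
    using set_projector_in_L2_space[OF assms] by (simp add: L2_space_def)
  show "integrable M (\<lambda>x. (cmod (f x))\<^sup>2)"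
    using assms by (simp add: L2_space_def)
qed (simp add: cmod_set_projector_power2 indicator_def)

text \<open>The almost-everywhere laws survive multiplication by an indicator, and any bound
  \<open>C\<close> for \<open>W\<close> remains a bound, since a cut-off does not increase the norm.
  It makes the estimates for bounded operators available for each piece pi_X W.\<close>

lemma bounded_operator_set_projector_comp:
  assumes "bounded_operator M W" "A \<in> sets M"
  shows "bounded_operator M (set_projector A \<circ> W)"
proof -
  obtain C where C: "\<forall>f\<in>L2_space M. L2_norm M (W f) \<le> C * L2_norm M f"
    using assms(1) by (auto simp: bounded_operator_def)
  have W: "f \<in> L2_space M \<Longrightarrow> W f \<in> L2_space M" for f
    using assms(1) by (simp add: bounded_operator_def)
  have "L2_norm M (set_projector A (W f)) \<le> C * L2_norm M f" if "f \<in> L2_space M" for f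
    using L2_norm_set_projector_le[OF assms(2) W[OF that]] C that by force
  moreover have "AE x in M. set_projector A (W (\<lambda>y. f y + g y)) x
      = set_projector A (W f) x + set_projector A (W g) x"
    if "f \<in> L2_space M" "g \<in> L2_space M" for f g
  proof -
    have "AE x in M. W (\<lambda>y. f y + g y) x = W f x + W g x"
      using assms(1) that by (simp add: bounded_operator_def)
    then show ?thesis
      by eventually_elim (simp add: set_projector_def algebra_simps)
  qed
  moreover have "AE x in M. set_projector A (W (\<lambda>y. c * f y)) x = c * set_projector A (W f) x"
    if "f \<in> L2_space M" for c f
  proof -
    have "AE x in M. W (\<lambda>y. c * f y) x = c * W f x"
      using assms(1) that by (simp add: bounded_operator_def)
    then show ?thesis
      by eventually_elim (simp add: set_projector_def algebra_simps)
  qed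
  ultimately show ?thesis
    using W assms(2) by (auto simp: bounded_operator_def intro: set_projector_in_L2_space)
qed

section \<open>Operator norms of W pi_A as suprema over the unit ball\<close>

lemma bdd_above_L2_norm_image_unit_ball:
  assumes "bounded_operator M W"
  shows "bdd_above ((\<lambda>f. L2_norm M (W f)) ` {f \<in> L2_space M. L2_norm M f \<le> 1})"
proof -
  obtain C where C: "\<forall>f\<in>L2_space M. L2_norm M (W f) \<le> C * L2_norm M f"
    using assms by (auto simp: bounded_operator_def)
  \<comment> \<open>Nothing forces \<open>C\<close> to be nonnegative; the absolute value lets
    \<open>L2_norm M f\<close> be replaced by 1.\<close>
  have "L2_norm M (W f) \<le> \<bar>C\<bar>" if "f \<in> L2_space M" "L2_norm M f \<le> 1" for f
  proof -
    have "L2_norm M (W f) \<le> C * L2_norm M f"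
      using C that by simp
    also have "\<dots> \<le> \<bar>C\<bar> * 1"
      using that by (intro mult_mono) (auto simp: L2_norm_nonneg)
    finally show ?thesis by simp
  qed
  then show ?thesis
    by (intro bdd_aboveI2) auto
qed

lemma L2_norm_le_operator_norm_comp_set_projector:
  assumes W: "bounded_operator M W" and A: "A \<in> sets M"
    and f: "f \<in> L2_space M" "L2_norm M f \<le> 1"
  shows "L2_norm M (W (set_projector A f)) \<le> operator_norm M (W \<circ> set_projector A)"
proof -
  let ?B = "{f \<in> L2_space M. L2_norm M f \<le> 1}"
  \<comment> \<open>A real \<open>SUP\<close> is an upper bound only for a set that is bounded
    above. As pi_A maps the unit ball into itself, the values of W pi_A there are among those of W,
    whose boundedness is known.\<close>
  have "set_projector A ` ?B \<subseteq> ?B"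
    using A by (auto intro: set_projector_in_L2_space order_trans[OF L2_norm_set_projector_le])
  then have "bdd_above ((\<lambda>f. L2_norm M (W f)) ` set_projector A ` ?B)"
    by (intro bdd_above_mono[OF bdd_above_L2_norm_image_unit_ball[OF W]] image_mono)
  then have "bdd_above ((\<lambda>f. L2_norm M ((W \<circ> set_projector A) f)) ` ?B)"
    by (simp add: image_image)
  from cSUP_upper[OF _ this, of f] show ?thesis
    using f by (simp add: operator_norm_def)
qed

lemma operator_norm_le:
  assumes "\<And>f. f \<in> L2_space M \<Longrightarrow> L2_norm M f \<le> 1 \<Longrightarrow> L2_norm M (V f) \<le> c"
  shows "operator_norm M V \<le> c"
proof -
  \<comment> \<open>\<open>cSUP_least\<close> asks for a nonempty index set; the zero function
    provides it.\<close>
  have "(\<lambda>x. 0) \<in> {f \<in> L2_space M. L2_norm M f \<le> 1}"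
    by (simp add: zero_in_L2_space L2_norm_zero)
  then show ?thesis
    unfolding operator_norm_def by (intro cSUP_least) (use assms in auto)
qed

lemma operator_norm_comp_set_projector_nonneg:
  assumes "bounded_operator M W" "A \<in> sets M"
  shows "0 \<le> operator_norm M (W \<circ> set_projector A)"
  using L2_norm_le_operator_norm_comp_set_projector[OF assms zero_in_L2_space]
  by (simp add: L2_norm_zero order_trans[OF L2_norm_nonneg])

text \<open>For A inside B, pi_A f = pi_B (pi_A f), and pi_A f is again in the unit ball. Hence each
  value entering the supremum for A also enters the one for B.\<close>

lemma operator_norm_comp_set_projector_mono:
  assumes W: "bounded_operator M W" and A: "A \<in> sets M" and B: "B \<in> sets M" and "A \<subseteq> B"
  shows "operator_norm M (W \<circ> set_projector A) \<le> operator_norm M (W \<circ> set_projector B)"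
proof (rule operator_norm_le)
  fix f assume f: "f \<in> L2_space M" "L2_norm M f \<le> 1"
  have "set_projector B (set_projector A f) = set_projector A f"
    using \<open>A \<subseteq> B\<close> by (auto simp: set_projector_def indicator_def fun_eq_iff)
  moreover have "L2_norm M (set_projector A f) \<le> 1"
    using L2_norm_set_projector_le[OF A f(1)] f(2) by simp
  ultimately show "L2_norm M ((W \<circ> set_projector A) f) \<le> operator_norm M (W \<circ> set_projector B)"
    using L2_norm_le_operator_norm_comp_set_projector[OF W B
        set_projector_in_L2_space[OF A f(1)]] by simp
qed

section \<open>Partitions up to null sets\<close>

context finite_measure
begin

text \<open>Covering and disjointness, both only up to null sets, are merged into one pointwise
  identity that can be multiplied by a function and integrated. With an indicator this gives
  additivity of the measure, with the squared modulus of f it gives Pythagoras.\<close>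

lemma is_partition_AE_sum_indicator:
  assumes "is_partition M J Y"
  shows "AE x in M. (\<Sum>j=1..J. indicator (Y j) x) = (1::real)"
proof -
  have Y: "\<And>j. j \<in> {1..J} \<Longrightarrow> Y j \<in> sets M"
    and cov: "measure M (space M - (\<Union>j\<in>{1..J}. Y j)) = 0"
    and disj: "\<And>j k. j \<in> {1..J} \<Longrightarrow> k \<in> {1..J} \<Longrightarrow> j \<noteq> k \<Longrightarrow> measure M (Y j \<inter> Y k) = 0"
    using assms by (auto simp: is_partition_def)
  have "space M - (\<Union>j\<in>{1..J}. Y j) \<in> null_sets M"
    using cov Y by (intro null_setsI) (auto simp: emeasure_eq_measure)
  then have "AE x in M. x \<in> (\<Union>j\<in>{1..J}. Y j)"
    by (rule AE_I') auto
  moreover have "AE x in M. \<forall>j\<in>{1..J}. \<forall>k\<in>{1..J}. j \<noteq> k \<longrightarrow> x \<notin> Y j \<inter> Y k"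
  proof (intro AE_finite_allI)
    fix j k assume jk: "j \<in> {1..J}" "k \<in> {1..J}"
    show "AE x in M. j \<noteq> k \<longrightarrow> x \<notin> Y j \<inter> Y k"
    proof (cases "j = k")
      case False
      then have "Y j \<inter> Y k \<in> null_sets M"
        using disj Y jk by (intro null_setsI) (auto simp: emeasure_eq_measure)
      then show ?thesis
        by (rule AE_I') auto
    qed simp
  qed auto
  ultimately show ?thesis
  proof eventually_elim
    case (elim x)
    then obtain j where j: "j \<in> {1..J}" "x \<in> Y j" by blast
    \<comment> \<open>Outside the null overlaps, \<open>j\<close> is the only index whose cell
      contains \<open>x\<close>.\<close>
    have "(\<Sum>k=1..J. indicator (Y k) x) = (\<Sum>k=1..J. if k = j then 1 else (0::real))"
      using elim j by (intro sum.cong) (auto simp: indicator_def)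
    also have "\<dots> = 1"
      using j by simp
    finally show ?case .
  qed
qed

lemma measure_eq_sum_is_partition:
  assumes Y: "is_partition M J Y" and A: "A \<in> sets M"
  shows "measure M A = (\<Sum>j=1..J. measure M (A \<inter> Y j))"
proof -
  have s: "\<And>j. j \<in> {1..J} \<Longrightarrow> Y j \<in> sets M"
    using Y by (simp add: is_partition_def)
  have "measure M A = (\<integral>x. indicator A x \<partial>M)"
    using A by simp
  also have "\<dots> = (\<integral>x. (\<Sum>j=1..J. indicator (A \<inter> Y j) x) \<partial>M)"
  proof (rule integral_cong_AE)
    show "AE x in M. indicator A x = (\<Sum>j=1..J. indicator (A \<inter> Y j) x :: real)"
      using is_partition_AE_sum_indicator[OF Y]
      by eventually_elim (simp add: indicator_inter_arith sum_distrib_left[symmetric])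
    show "(\<lambda>x. \<Sum>j=1..J. indicator (A \<inter> Y j) x :: real) \<in> borel_measurable M"
      using A s by (intro borel_measurable_sum borel_measurable_indicator) auto
  qed (use A in simp)
  also have "\<dots> = (\<Sum>j=1..J. measure M (A \<inter> Y j))"
    using A s by (subst Bochner_Integration.integral_sum)
      (auto simp: emeasure_eq_measure intro!: sum.cong)
  finally show ?thesis .
qed

lemma L2_norm_power2_eq_sum_is_partition:
  assumes X: "is_partition M K X" and f: "f \<in> L2_space M"
  shows "(L2_norm M f)\<^sup>2 = (\<Sum>k=1..K. (L2_norm M (set_projector (X k) f))\<^sup>2)"
proof -
  have i: "integrable M (\<lambda>x. (cmod (set_projector (X k) f x))\<^sup>2)" if "k \<in> {1..K}" for k
    using set_projector_in_L2_space[OF _ f, of "X k"] X that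
    by (simp add: L2_space_def is_partition_def)
  have [measurable]: "f \<in> borel_measurable M"
    using f by (simp add: L2_space_def)
  have "(\<integral>x. (cmod (f x))\<^sup>2 \<partial>M) = (\<integral>x. (\<Sum>k=1..K. (cmod (set_projector (X k) f x))\<^sup>2) \<partial>M)"
  proof (rule integral_cong_AE)
    show "AE x in M. (cmod (f x))\<^sup>2 = (\<Sum>k=1..K. (cmod (set_projector (X k) f x))\<^sup>2)"
      using is_partition_AE_sum_indicator[OF X]
      by eventually_elim (simp add: cmod_set_projector_power2 sum_distrib_right[symmetric])
    show "(\<lambda>x. \<Sum>k=1..K. (cmod (set_projector (X k) f x))\<^sup>2) \<in> borel_measurable M"
      using i by (intro borel_measurable_sum borel_measurable_integrable)
  qed simp
  also have "\<dots> = (\<Sum>k=1..K. \<integral>x. (cmod (set_projector (X k) f x))\<^sup>2 \<partial>M)"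
    using i by (rule Bochner_Integration.integral_sum)
  finally show ?thesis
    by (simp add: L2_norm_power2)
qed

section \<open>Common refinements and their effect on \<open>M_part\<close>\<close>

lemma is_partition_trivial: "is_partition M 1 (\<lambda>_. space M)"
  by (simp add: is_partition_def)

text \<open>The cells are naturally indexed by pairs, while \<open>is_partition\<close> wants
  indices from 1 to N; an arbitrary bijection \<open>h\<close> renumbers them. A point missed by the
  cells is missed by Y or by Z. Distinct indices give pairs differing in some coordinate, so the
  overlap lies in a null overlap of two sets Y or of two sets Z.\<close>

lemma is_partition_common_refinement:
  assumes Y: "is_partition M J Y" and Z: "is_partition M L Z"
    and h: "bij_betw h {1..J * L} ({1..J} \<times> {1..L})"
  shows "is_partition M (J * L) (\<lambda>i. Y (fst (h i)) \<inter> Z (snd (h i)))"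
proof -
  have hin: "fst (h i) \<in> {1..J}" "snd (h i) \<in> {1..L}" if "i \<in> {1..J * L}" for i
    using bij_betwE[OF h] that by (auto simp: mem_Times_iff)
  have Ys: "\<And>j. j \<in> {1..J} \<Longrightarrow> Y j \<in> sets M" and Zs: "\<And>l. l \<in> {1..L} \<Longrightarrow> Z l \<in> sets M"
    using Y Z by (auto simp: is_partition_def)
  have Yd: "\<And>j k. j \<in> {1..J} \<Longrightarrow> k \<in> {1..J} \<Longrightarrow> j \<noteq> k \<Longrightarrow> measure M (Y j \<inter> Y k) = 0"
    and Zd: "\<And>l m. l \<in> {1..L} \<Longrightarrow> m \<in> {1..L} \<Longrightarrow> l \<noteq> m \<Longrightarrow> measure M (Z l \<inter> Z m) = 0"
    using Y Z by (simp_all add: is_partition_def)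
  have Un: "(\<Union>i\<in>{1..J * L}. Y (fst (h i)) \<inter> Z (snd (h i)))
      = (\<Union>j\<in>{1..J}. Y j) \<inter> (\<Union>l\<in>{1..L}. Z l)"
  proof -
    have "(\<Union>i\<in>{1..J * L}. Y (fst (h i)) \<inter> Z (snd (h i)))
        = (\<Union>p\<in>h ` {1..J * L}. Y (fst p) \<inter> Z (snd p))"
      by simp
    also have "\<dots> = (\<Union>p\<in>{1..J} \<times> {1..L}. Y (fst p) \<inter> Z (snd p))"
      using h by (simp only: bij_betw_def)
    finally show ?thesis by auto
  qed
  have "measure M (space M - (\<Union>i\<in>{1..J * L}. Y (fst (h i)) \<inter> Z (snd (h i))))
      \<le> measure M ((space M - (\<Union>j\<in>{1..J}. Y j)) \<union> (space M - (\<Union>l\<in>{1..L}. Z l)))"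
    unfolding Un using Ys Zs by (intro finite_measure_mono sets.Un sets.Diff sets.finite_UN) auto
  also have "\<dots> \<le> measure M (space M - (\<Union>j\<in>{1..J}. Y j)) + measure M (space M - (\<Union>l\<in>{1..L}. Z l))"
    using Ys Zs by (intro measure_Un_le sets.Diff sets.finite_UN) auto
  also have "\<dots> = 0"
    using Y Z by (simp add: is_partition_def)
  finally have cov: "measure M (space M - (\<Union>i\<in>{1..J * L}. Y (fst (h i)) \<inter> Z (snd (h i)))) = 0"
    by (simp add: measure_le_0_iff)
  have "measure M ((Y (fst (h i)) \<inter> Z (snd (h i))) \<inter> (Y (fst (h k)) \<inter> Z (snd (h k)))) = 0"
    (is "measure M ?I = 0")
    if i: "i \<in> {1..J * L}" and k: "k \<in> {1..J * L}" and "i \<noteq> k" for i k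
  proof -
    have "h i \<noteq> h k"
      using inj_on_eq_iff[OF bij_betw_imp_inj_on[OF h] i k] \<open>i \<noteq> k\<close> by simp
    then consider "fst (h i) \<noteq> fst (h k)" | "snd (h i) \<noteq> snd (h k)"
      by (meson prod_eqI)
    then have "measure M ?I \<le> 0"
    proof cases
      case 1
      then have "measure M (Y (fst (h i)) \<inter> Y (fst (h k))) = 0"
        by (intro Yd hin i k)
      moreover have "measure M ?I \<le> measure M (Y (fst (h i)) \<inter> Y (fst (h k)))"
        by (intro finite_measure_mono sets.Int Ys hin i k) blast
      ultimately show ?thesis by simp
    next
      case 2
      then have "measure M (Z (snd (h i)) \<inter> Z (snd (h k))) = 0"
        by (intro Zd hin i k)
      moreover have "measure M ?I \<le> measure M (Z (snd (h i)) \<inter> Z (snd (h k)))"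
        by (intro finite_measure_mono sets.Int Zs hin i k) blast
      ultimately show ?thesis by simp
    qed
    then show ?thesis
      by (simp add: measure_le_0_iff)
  qed
  with cov show ?thesis
    unfolding is_partition_def by (intro conjI ballI impI sets.Int Ys Zs hin)
qed

text \<open>Monotonicity replaces \<phi> on each cell \<open>Y j \<inter> Z l\<close> by its value
  on \<open>Y j\<close>, after which the measures of these cells add up to that of
  \<open>Y j\<close>. Keeping \<phi> abstract and the cells as a double sum allows the roles of Y
  and Z to be exchanged.\<close>

lemma sum_measure_times_mono_refine:
  fixes \<phi> :: "'a set \<Rightarrow> real"
  assumes Ys: "\<And>j. j \<in> {1..J} \<Longrightarrow> Y j \<in> sets M" and Z: "is_partition M L Z"
    and mono: "\<And>A B. A \<in> sets M \<Longrightarrow> B \<in> sets M \<Longrightarrow> A \<subseteq> B \<Longrightarrow> \<phi> A \<le> \<phi> B"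
  shows "(\<Sum>j=1..J. \<Sum>l=1..L. measure M (Y j \<inter> Z l) * \<phi> (Y j \<inter> Z l))
    \<le> (\<Sum>j=1..J. measure M (Y j) * \<phi> (Y j))"
proof (rule sum_mono)
  fix j assume j: "j \<in> {1..J}"
  have "(\<Sum>l=1..L. measure M (Y j \<inter> Z l) * \<phi> (Y j \<inter> Z l))
      \<le> (\<Sum>l=1..L. measure M (Y j \<inter> Z l) * \<phi> (Y j))"
    using Z Ys[OF j] by (intro sum_mono mult_left_mono mono) (auto simp: is_partition_def)
  also have "\<dots> = measure M (Y j) * \<phi> (Y j)"
    using measure_eq_sum_is_partition[OF Z Ys[OF j]] by (simp add: sum_distrib_right)
  finally show "(\<Sum>l=1..L. measure M (Y j \<inter> Z l) * \<phi> (Y j \<inter> Z l)) \<le> measure M (Y j) * \<phi> (Y j)" .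
qed

text \<open>The refinement is fixed before \<open>V\<close> is chosen. This uniformity is essential
  later, where a single partition has to serve the different operators pi_X W.\<close>

lemma M_part_refine:
  assumes Y: "is_partition M J Y" and Z: "is_partition M L Z"
  obtains N U where "is_partition M N U"
    "\<And>V. bounded_operator M V \<Longrightarrow> M_part M N U V \<le> M_part M J Y V"
    "\<And>V. bounded_operator M V \<Longrightarrow> M_part M N U V \<le> M_part M L Z V"
proof -
  obtain h where h: "bij_betw h {1..J * L} ({1..J} \<times> {1..L})"
    using finite_same_card_bij[of "{1..J * L}" "{1..J} \<times> {1..L}"] by auto
  let ?U = "\<lambda>i. Y (fst (h i)) \<inter> Z (snd (h i))"
  have Ys: "\<And>j. j \<in> {1..J} \<Longrightarrow> Y j \<in> sets M" and Zs: "\<And>l. l \<in> {1..L} \<Longrightarrow> Z l \<in> sets M"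
    using Y Z by (auto simp: is_partition_def)
  have *: "M_part M (J * L) ?U V \<le> M_part M J Y V \<and> M_part M (J * L) ?U V \<le> M_part M L Z V"
    if V: "bounded_operator M V" for V
  proof -
    define \<phi> where "\<phi> A = (operator_norm M (V \<circ> set_projector A))\<^sup>2" for A
    have mono: "\<phi> A \<le> \<phi> B" if "A \<in> sets M" "B \<in> sets M" "A \<subseteq> B" for A B
      unfolding \<phi>_def using V that
      by (intro power_mono operator_norm_comp_set_projector_mono
          operator_norm_comp_set_projector_nonneg)
    have "M_part M (J * L) ?U V
        = (\<Sum>p\<in>{1..J} \<times> {1..L}. measure M (Y (fst p) \<inter> Z (snd p)) * \<phi> (Y (fst p) \<inter> Z (snd p)))"
      unfolding M_part_def \<phi>_def
      using sum.reindex_bij_betw[OF h, where g = "\<lambda>p. measure M (Y (fst p) \<inter> Z (snd p)) *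
        (operator_norm M (V \<circ> set_projector (Y (fst p) \<inter> Z (snd p))))\<^sup>2"] .
    also have "\<dots> = (\<Sum>j=1..J. \<Sum>l=1..L. measure M (Y j \<inter> Z l) * \<phi> (Y j \<inter> Z l))"
      by (simp add: sum.cartesian_product split_def)
    finally have eq: "M_part M (J * L) ?U V = \<dots>" .
    \<comment> \<open>Grouping the same cells by \<open>l\<close> first exhibits them as a
      refinement of Z.\<close>
    then have eq': "M_part M (J * L) ?U V
        = (\<Sum>l=1..L. \<Sum>j=1..J. measure M (Z l \<inter> Y j) * \<phi> (Z l \<inter> Y j))"
      by (subst sum.swap) (simp add: Int_commute)
    have M_part: "M_part M I P V = (\<Sum>i=1..I. measure M (P i) * \<phi> (P i))" for I P
      by (simp add: M_part_def \<phi>_def)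
    have "M_part M (J * L) ?U V \<le> M_part M J Y V"
      unfolding eq M_part[of J Y] by (rule sum_measure_times_mono_refine[OF Ys Z mono])
    moreover have "M_part M (J * L) ?U V \<le> M_part M L Z V"
      unfolding eq' M_part[of L Z] by (rule sum_measure_times_mono_refine[OF Zs Y mono])
    ultimately show ?thesis ..
  qed
  show thesis
    by (rule that[OF is_partition_common_refinement[OF Y Z h]]) (use * in auto)
qed

lemma M_part_refine_finite:
  fixes K :: nat
  assumes "\<And>k. k \<in> {1..K} \<Longrightarrow> is_partition M (J k) (Y k)"
  shows "\<exists>N U. is_partition M N U \<and>
    (\<forall>k\<in>{1..K}. \<forall>V. bounded_operator M V \<longrightarrow> M_part M N U V \<le> M_part M (J k) (Y k) V)"
  using assms
proof (induction K)
  case 0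
  show ?case
    \<comment> \<open>With no partitions to refine, the inequalities are vacuous and any partition
      serves as the witness.\<close>
    using is_partition_trivial by auto
next
  case (Suc K)
  then obtain N U where U: "is_partition M N U"
    and le: "\<forall>k\<in>{1..K}. \<forall>V. bounded_operator M V \<longrightarrow> M_part M N U V \<le> M_part M (J k) (Y k) V"
    by (metis atLeastAtMost_iff le_SucI)
  \<comment> \<open>The partition \<open>U\<close> already handles the indices up to
    \<open>K\<close>; refining it once more against \<open>Y (Suc K)\<close> keeps those bounds by
    transitivity.\<close>
  obtain N' U' where U': "is_partition M N' U'"
    and U'_le: "\<And>V. bounded_operator M V \<Longrightarrow> M_part M N' U' V \<le> M_part M N U V"
    and U'_le_Suc: "\<And>V. bounded_operator M V \<Longrightarrow>
      M_part M N' U' V \<le> M_part M (J (Suc K)) (Y (Suc K)) V"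
    using M_part_refine[OF U Suc.prems[of "Suc K"]] by auto
  have "M_part M N' U' V \<le> M_part M (J k) (Y k) V"
    if "k \<in> {1..Suc K}" "bounded_operator M V" for k V
  proof (cases "k = Suc K")
    case False
    then have "k \<in> {1..K}"
      using that by auto
    then show ?thesis
      using le U'_le that by (blast intro: order_trans)
  qed (use U'_le_Suc that in simp)
  with U' show ?case
    by blast
qed

section \<open>Splitting the range of W by Pythagoras\<close>

lemma operator_norm_power2_le_sum_is_partition:
  assumes W: "bounded_operator M W" and X: "is_partition M K X" and A: "A \<in> sets M"
  shows "(operator_norm M (W \<circ> set_projector A))\<^sup>2
    \<le> (\<Sum>k=1..K. (operator_norm M (set_projector (X k) \<circ> W \<circ> set_projector A))\<^sup>2)" (is "_ \<le> ?S")
proof -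
  \<comment> \<open>Pythagoras holds vector by vector, so the bound is proved for each f in the unit
    ball and the supremum is taken last; the square root puts it in the form of
    \<open>operator_norm_le\<close>.\<close>
  have "operator_norm M (W \<circ> set_projector A) \<le> sqrt ?S"
  proof (rule operator_norm_le, rule real_le_rsqrt)
    fix f assume f: "f \<in> L2_space M" "L2_norm M f \<le> 1"
    have "W (set_projector A f) \<in> L2_space M"
      using W set_projector_in_L2_space[OF A f(1)] by (simp add: bounded_operator_def)
    then have "(L2_norm M (W (set_projector A f)))\<^sup>2
        = (\<Sum>k=1..K. (L2_norm M ((set_projector (X k) \<circ> W) (set_projector A f)))\<^sup>2)"
      using L2_norm_power2_eq_sum_is_partition[OF X] by simp
    also have "\<dots> \<le> ?S"
      using X by (intro sum_mono power_mono L2_norm_nonneg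
          L2_norm_le_operator_norm_comp_set_projector[OF _ A f]
          bounded_operator_set_projector_comp[OF W]) (simp add: is_partition_def)
    finally show "(L2_norm M ((W \<circ> set_projector A) f))\<^sup>2 \<le> ?S"
      by simp
  qed
  then have "(operator_norm M (W \<circ> set_projector A))\<^sup>2 \<le> (sqrt ?S)\<^sup>2"
    by (intro power_mono operator_norm_comp_set_projector_nonneg[OF W A])
  then show ?thesis
    by (simp add: sum_nonneg)
qed

text \<open>The cell-wise estimate is weighted by \<open>measure M (U j)\<close> and the two sums
  are exchanged. The same \<open>U\<close> has to appear on both sides, which is why the
  near-optimal partitions are first replaced by a common refinement.\<close>

lemma M_part_le_sum_is_partition:
  assumes W: "bounded_operator M W" and X: "is_partition M K X" and U: "is_partition M N U"
  shows "M_part M N U W \<le> (\<Sum>k=1..K. M_part M N U (set_projector (X k) \<circ> W))"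
proof -
  have "M_part M N U W \<le> (\<Sum>j=1..N. measure M (U j) *
      (\<Sum>k=1..K. (operator_norm M (set_projector (X k) \<circ> W \<circ> set_projector (U j)))\<^sup>2))"
    unfolding M_part_def using U
    by (intro sum_mono mult_left_mono operator_norm_power2_le_sum_is_partition[OF W X])
      (auto simp: is_partition_def)
  also have "\<dots> = (\<Sum>k=1..K. M_part M N U (set_projector (X k) \<circ> W))"
    unfolding M_part_def sum_distrib_left by (rule sum.swap)
  finally show ?thesis .
qed

end

section \<open>The infimum over partitions, and the conclusion\<close>

lemma M_part_nonneg: "0 \<le> M_part M J Y W"
  by (simp add: M_part_def sum_nonneg)

lemma mu_norm_power2_le_M_part:
  assumes "is_partition M J Y"
  shows "(mu_norm M W)\<^sup>2 \<le> M_part M J Y W"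
proof -
  let ?S = "{sqrt (M_part M J Y W) | J Y. is_partition M J Y}"
  have mem: "sqrt (M_part M J Y W) \<in> ?S"
    using assms by blast
  \<comment> \<open>Squaring preserves the bound by the infimum only once \<open>mu_norm\<close> is
    known to be nonnegative.\<close>
  have "0 \<le> mu_norm M W"
    unfolding mu_norm_def using mem by (intro cInf_greatest) (auto simp: M_part_nonneg)
  moreover have "mu_norm M W \<le> sqrt (M_part M J Y W)"
    unfolding mu_norm_def by (rule cInf_lower[OF mem], rule bdd_belowI[of _ 0])
      (auto simp: M_part_nonneg)
  ultimately have "(mu_norm M W)\<^sup>2 \<le> (sqrt (M_part M J Y W))\<^sup>2"
    by (intro power_mono)
  then show ?thesis
    by (simp add: M_part_nonneg)
qed

lemma (in finite_measure) ex_partition_M_part_less: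
  assumes "0 < e"
  shows "\<exists>J Y. is_partition M J Y \<and> M_part M J Y W < (mu_norm M W)\<^sup>2 + e"
proof -
  let ?S = "{sqrt (M_part M J Y W) | J Y. is_partition M J Y}"
  have "?S \<noteq> {}"
    using is_partition_trivial by blast
  \<comment> \<open>The infimum runs over square roots, so the slack \<open>e\<close> is placed
    under the root; since \<open>e\<close> is positive, this number strictly exceeds
    \<open>mu_norm M W\<close> and some member of \<open>?S\<close> lies below it.\<close>
  moreover have "Inf ?S < sqrt ((mu_norm M W)\<^sup>2 + e)"
    using assms by (simp add: mu_norm_def[symmetric] real_less_rsqrt)
  ultimately obtain s where "s \<in> ?S" "s < sqrt ((mu_norm M W)\<^sup>2 + e)"
    by (meson cInf_lessD)
  then show ?thesis
    by fastforce
qed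

theorem lemma4p2:
  fixes M :: "'a measure"
    and W :: "('a \<Rightarrow> complex) \<Rightarrow> ('a \<Rightarrow> complex)"
    and K :: nat
    and X :: "nat \<Rightarrow> 'a set"
  assumes "prob_space M"
    and "bounded_operator M W"
    and "is_partition M K X"
  shows "(mu_norm M W)\<^sup>2 \<le> (\<Sum>k=1..K. (mu_norm M (set_projector (X k) \<circ> W))\<^sup>2)"
\<comment> \<open>The infima need not be attained, so the inequality is proved with an arbitrary
  positive error \<open>e\<close>.\<close>
proof (rule field_le_epsilon)
  fix e :: real assume "0 < e"
  interpret prob_space M by fact
  \<comment> \<open>The error is shared among the \<open>K\<close> terms; adding 1 to the
    denominator keeps it nonzero when \<open>K = 0\<close>.\<close>
  define d where "d = e / (real K + 1)"
  have "0 < d" and d: "real K * d \<le> e"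
    using \<open>0 < e\<close> by (simp_all add: d_def field_simps)
  let ?V = "\<lambda>k. set_projector (X k) \<circ> W"
  have V: "bounded_operator M (?V k)" if "k \<in> {1..K}" for k
    using bounded_operator_set_projector_comp[OF assms(2)] assms(3) that
    by (simp add: is_partition_def)
  have "\<forall>k. \<exists>J Y. is_partition M J Y \<and> M_part M J Y (?V k) < (mu_norm M (?V k))\<^sup>2 + d"
    using ex_partition_M_part_less[OF \<open>0 < d\<close>] by blast
  then obtain J Y where Y: "\<And>k. is_partition M (J k) (Y k)"
    and less: "\<And>k. M_part M (J k) (Y k) (?V k) < (mu_norm M (?V k))\<^sup>2 + d"
    by metis
  obtain N U where U: "is_partition M N U"
    and le: "\<And>k V. k \<in> {1..K} \<Longrightarrow> bounded_operator M V \<Longrightarrow>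
      M_part M N U V \<le> M_part M (J k) (Y k) V"
    using M_part_refine_finite[of K J Y] Y by blast
  have "(mu_norm M W)\<^sup>2 \<le> M_part M N U W"
    by (rule mu_norm_power2_le_M_part[OF U])
  also have "\<dots> \<le> (\<Sum>k=1..K. M_part M N U (?V k))"
    by (rule M_part_le_sum_is_partition[OF assms(2,3) U])
  also have "\<dots> \<le> (\<Sum>k=1..K. (mu_norm M (?V k))\<^sup>2 + d)"
    \<comment> \<open>On \<open>U\<close>, each \<open>M_part\<close> is at most its value on the
      partition chosen for that \<open>k\<close>, which is within \<open>d\<close> of the squared
      mu-norm.\<close>
    using le V less by (intro sum_mono) (meson less_imp_le order_trans)
  also have "\<dots> \<le> (\<Sum>k=1..K. (mu_norm M (?V k))\<^sup>2) + e"
    using d by (simp add: sum.distrib)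
  finally show "(mu_norm M W)\<^sup>2 \<le> (\<Sum>k=1..K. (mu_norm M (?V k))\<^sup>2) + e" .
qed

end
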